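(* Let $(\mathcal D_n)_{n\ge1}$ be a sequence of feasible degree sequences such that there exist $d_1=d_1(n)$, $d_2=d_2(n)$ with $1\le d_2\le d_1$, and $\omega=\omega(n)\to\infty$ as $n\to\infty$, satisfying $$|S_n(\omega^{-1}d_2)\setminus S_n(\omega d_1)|=o(n).$$ Let $p_1=\frac1{d_1}$ and $p_2=\frac1{d_2}$. Then $$\mathbb P\left[L_1(\mathbf G(\mathcal D_n)_{p_2})-L_1(\mathbf G(\mathcal D_n)_{p_1})=o(n)\right]=1-o(1).$$
   Context: For each $n$, $\mathcal D_n=(d_1,\dots,d_n)$ is a sequence of integers, each $\ge 1$ (depending on $n$; not to be confused with the functions $d_1(n),d_2(n)$ of the claim), that is feasible, i.e. there is a simple graph on $[n]$ with this degree sequence. $\mathbf G(\mathcal D_n)$ is a uniformly random simple graph on $[n]$ among those in which each vertex $i$ has the $i$-th entry of $\mathcal D_n$ as its degree. For a graph $G$ and $p\in[0,1]$, $G_p$ is the random subgraph on the same vertex set in which each edge of $G$ is kept independently with probability $p$. For $p_1\le p_2$ the $p_1$- and $p_2$-percolations of the same graph are coupled in the natural way, as a two-stage process: first each edge is kept with probability $p_1$ (giving $G_{p_1}$), then each edge not kept gets a second independent chance with probability $(p_2-p_1)/(1-p_1)$ (giving $G_{p_2}\supseteq G_{p_1}$). $L_1(G)$ is the number of vertices of a largest component of $G$. $S_n(x)$ is the set of vertices in $[n]$ whose prescribed degree is at least $x$ ($x$ real). Asymptotics are as $n\to\infty$; the conclusion means that for some $h(n)=o(n)$ the probability that the difference is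 at most $h(n)$ tends to $1$. *)

theory Defs
  imports "HOL-Probability.Probability" "HOL-Library.Landau_Symbols"
begin

text \<open>
  A graph is given by its vertex set together with its set of edges, an edge being a
  two-element set of vertices. The vertex set \<open>[n]\<close> is \<open>{1..n}\<close>.
\<close>

definition simple_graph :: "'a set \<Rightarrow> 'a set set \<Rightarrow> bool" where
  "simple_graph V E \<longleftrightarrow> (\<forall>e\<in>E. e \<subseteq> V \<and> card e = 2)"

definition vertex_degree :: "'a set set \<Rightarrow> 'a \<Rightarrow> nat" where
  "vertex_degree E v = card {e \<in> E. v \<in> e}"

text \<open>
  A degree sequence of length \<open>n\<close> is a function \<open>D\<close> of which only the values
  on \<open>{1..n}\<close> matter.
\<close>

definition graphs_with_degrees :: "nat \<Rightarrow> (nat \<Rightarrow> nat) \<Rightarrow> nat set set set" where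
  "graphs_with_degrees n D = {E. simple_graph {1..n} E \<and> (\<forall>i\<in>{1..n}. vertex_degree E i = D i)}"

definition feasible :: "nat \<Rightarrow> (nat \<Rightarrow> nat) \<Rightarrow> bool" where
  "feasible n D \<longleftrightarrow> (\<exists>E. simple_graph {1..n} E \<and> (\<forall>i\<in>{1..n}. vertex_degree E i = D i))"

lemma finite_graphs_with_degrees: "finite (graphs_with_degrees n D)"
  by (rule finite_subset[of _ "Pow (Pow {1..n})"])
    (auto simp: graphs_with_degrees_def simple_graph_def)

lemma feasible_iff: "feasible n D \<longleftrightarrow> graphs_with_degrees n D \<noteq> {}"
  by (auto simp: feasible_def graphs_with_degrees_def)

text \<open>Meaningful only for feasible \<open>D\<close>, since \<^const>\<open>pmf_of_set\<close> needs a nonempty set.\<close>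

definition random_graph :: "nat \<Rightarrow> (nat \<Rightarrow> nat) \<Rightarrow> nat set set pmf" where
  "random_graph n D = pmf_of_set (graphs_with_degrees n D)"

definition percolate :: "real \<Rightarrow> 'a set set \<Rightarrow> 'a set set pmf" where
  "percolate p E = map_pmf (\<lambda>X. {e \<in> E. X e}) (Pi_pmf E False (\<lambda>_. bernoulli_pmf p))"

text \<open>
  The joint law of \<open>(G\<^sub>p\<^sub>1, G\<^sub>p\<^sub>2)\<close> in the two-stage coupling, for \<open>p1 \<le> p2\<close>. If
  \<open>p1 = 1\<close> the retention probability of the second stage is the junk value \<open>0\<close>, which is
  harmless because then no edge is left over after the first stage.
\<close>

definition percolation_coupling ::
    "real \<Rightarrow> real \<Rightarrow> 'a set set \<Rightarrow> ('a set set \<times> 'a set set) pmf" where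
  "percolation_coupling p1 p2 E =
     bind_pmf (percolate p1 E) (\<lambda>A.
       map_pmf (\<lambda>B. (A, A \<union> B)) (percolate ((p2 - p1) / (1 - p1)) (E - A)))"

definition graph_components :: "'a set \<Rightarrow> 'a set set \<Rightarrow> 'a set set" where
  "graph_components V E = V // {(u, v) \<in> V \<times> V. (u, v) \<in> {(x, y). {x, y} \<in> E}\<^sup>*}"

definition L1 :: "'a set \<Rightarrow> 'a set set \<Rightarrow> nat" where
  "L1 V E = Max (card ` graph_components V E)"

definition S :: "nat \<Rightarrow> (nat \<Rightarrow> nat) \<Rightarrow> real \<Rightarrow> nat set" where
  "S n D x = {i \<in> {1..n}. x \<le> real (D i)}"

end

theory Submission
  imports Defs
begin

text \<open>
  Fix \<open>n\<close>, and split the vertices into low ones (degree below \<open>d2 / \<omega>\<close>), high ones (degree at least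
  \<open>\<omega> d1\<close>, the set \<open>H\<close>) and the remaining \<open>o(n)\<close> medium ones. A low vertex keeps an edge
  in the \<open>p2\<close>-percolation with probability at most \<open>1 / \<omega>\<close>. So almost all low vertices are isolated,
  and the largest component there has at most \<open>|H| + o(n)\<close> vertices. It remains to see that
  the \<open>p1\<close>-percolation has a component with at least \<open>|H| - o(n)\<close> vertices.

  Such a component exists as soon as every cut \<open>(A, B)\<close> of the vertex set with at least
  \<open>m = n / \<surd>\<omega>\<close> high vertices on both sides is crossed by a surviving edge
  (\<open>L1_ge_of_no_empty_cut\<close>). There are at most \<open>2\<^sup>n\<close> cuts, and a cut with more than \<open>2 n d1\<close> edges is wiped
  out with probability at most \<open>exp (- 2 n)\<close>. Hence it suffices that, for a fixed cut of this kind, the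
  random graph has at most \<open>2 n d1\<close> crossing edges with probability at most \<open>1 / 16\<^sup>n\<close>
  (\<open>sparse_cut_prob\<close>).

  This is a switching argument. Suppose that few edges cross, and put \<open>\<eta> = \<omega> d1 / 4\<close>. Then at least
  half of the high vertices on either side have at most \<open>\<eta>\<close> neighbours on the other side,
  hence at least \<open>3 \<eta>\<close> neighbours on their own. Take such a vertex \<open>a\<close> in \<open>A\<close> with a neighbour \<open>a'\<close> in
  \<open>A\<close>, and likewise \<open>b, b'\<close> in \<open>B\<close>, and replace \<open>{a, a'}, {b, b'}\<close> by \<open>{a, b'}, {b, a'}\<close>. This preserves
  all degrees and adds two crossing edges. It is important to join \<open>a\<close> to \<open>b'\<close> and not to \<open>b\<close>: then
  each of the two new edges has an end with few neighbours across, so that a constant fraction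
  of all choices is admissible even if the neighbours \<open>a'\<close> and \<open>b'\<close> have degree of order \<open>n\<close>.
  This yields at least of the order of \<open>(\<omega> d1 m)\<^sup>2 = \<omega> (n d1)\<^sup>2\<close> switchings out of a graph, whereas a
  graph with at most \<open>4 n d1\<close> crossing edges is reached by at most \<open>(4 n d1)\<^sup>2\<close> switchings. Hence allowing
  two more crossing edges multiplies the number of graphs by at least \<open>16\<close> once \<open>\<omega>\<close> is large
  (\<open>switching_step\<close>), and doing so \<open>n\<close> times gives the bound.
\<close>

section \<open>Light vertices and admissible switchings\<close>

definition edge_cut :: "'a set set \<Rightarrow> 'a set \<Rightarrow> 'a set set" where
  "edge_cut E A = {e \<in> E. e \<inter> A \<noteq> {} \<and> \<not> e \<subseteq> A}"

definition nbrs :: "'a set set \<Rightarrow> 'a set \<Rightarrow> 'a \<Rightarrow> 'a set" where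
  "nbrs E B v = {x \<in> B. {v, x} \<in> E}"

lemma simple_graph_finite: "finite V \<Longrightarrow> simple_graph V E \<Longrightarrow> finite E"
  by (rule finite_subset[of _ "Pow V"]) (auto simp: simple_graph_def)

lemma simple_graph_edgeD:
  assumes "simple_graph V E" "{x, y} \<in> E" shows "x \<noteq> y" "x \<in> V" "y \<in> V"
  using assms by (auto simp: simple_graph_def)

lemma finite_nbrs: "finite B \<Longrightarrow> finite (nbrs E B v)"
  by (auto simp: nbrs_def)

lemma vertex_degree_eq_nbrs:
  assumes "simple_graph V E" "v \<in> V"
  shows "vertex_degree E v = card (nbrs E V v)"
proof -
  have "{e \<in> E. v \<in> e} = (\<lambda>x. {v, x}) ` nbrs E V v"
  proof (intro equalityI subsetI)
    fix e assume e: "e \<in> {e \<in> E. v \<in> e}"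
    then have "card e = 2" "e \<subseteq> V" using assms by (auto simp: simple_graph_def)
    then obtain x y where "e = {x, y}" by (auto simp: card_2_iff)
    then show "e \<in> (\<lambda>x. {v, x}) ` nbrs E V v"
      using e \<open>e \<subseteq> V\<close> by (auto simp: nbrs_def insert_commute)
  qed (auto simp: nbrs_def)
  moreover have "inj_on (\<lambda>x. {v, x}) (nbrs E V v)"
    by (auto simp: inj_on_def doubleton_eq_iff)
  ultimately show ?thesis by (simp add: vertex_degree_def card_image)
qed

lemma card_nbrs_split:
  assumes "finite V" "A \<subseteq> V"
  shows "card (nbrs E V v) = card (nbrs E A v) + card (nbrs E (V - A) v)"
proof -
  have "nbrs E V v = nbrs E A v \<union> nbrs E (V - A) v" using assms by (auto simp: nbrs_def)
  moreover have "finite A" using assms by (rule finite_subset[rotated])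
  ultimately show ?thesis using assms(1)
    by (simp only:) (rule card_Un_disjoint, auto simp: finite_nbrs, auto simp: nbrs_def)
qed

lemma edge_cut_Compl:
  assumes "simple_graph V E" "A \<subseteq> V"
  shows "edge_cut E (V - A) = edge_cut E A"
  using assms by (auto simp: edge_cut_def simple_graph_def)

text \<open>
  A switching will replace edges \<open>{a, a'}\<close> inside \<open>A\<close> and \<open>{b, b'}\<close> outside \<open>A\<close> by \<open>{a, b'}\<close> and
  \<open>{b, a'}\<close>. Only \<open>a\<close> and \<open>b\<close> have to have few neighbours on the opposite side; \<open>a'\<close> and \<open>b'\<close> may be
  hubs. This asymmetry is what allows arbitrary maximum degree.
\<close>
definition light :: "'a set set \<Rightarrow> 'a set \<Rightarrow> real \<Rightarrow> 'a set \<Rightarrow> 'a set" where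
  "light E B \<eta> X = {a \<in> X. real (card (nbrs E B a)) \<le> \<eta>}"

definition arcs :: "'a set set \<Rightarrow> 'a set \<Rightarrow> 'a set \<Rightarrow> ('a \<times> 'a) set" where
  "arcs E A X = (SIGMA a:X. nbrs E A a)"

text \<open>
  The vertices of \<open>X\<close> that are not light send more than \<open>\<eta>\<close> edges each across the cut, and distinct pairs of
  such a vertex and a neighbour on the other side are distinct cut edges. So a cut with at most
  \<open>\<eta> |X| / 2\<close> edges leaves at least half of \<open>X\<close> light.
\<close>
lemma card_light:
  assumes V: "finite V" "simple_graph V E" "A \<subseteq> V" "X \<subseteq> A"
    and c: "real (card (edge_cut E A)) \<le> \<eta> * real (card X) / 2" and \<eta>: "0 < \<eta>"
  shows "real (card X) / 2 \<le> real (card (light E (V - A) \<eta> X))"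
proof -
  define Y where "Y = X - light E (V - A) \<eta> X"
  have fin: "finite A" "finite X" "finite Y" "finite (V - A)"
    using V finite_subset[OF V(3)] finite_subset[OF V(4)] by (auto simp: Y_def)
  have "inj_on (\<lambda>(a, b). {a, b}) (SIGMA a:Y. nbrs E (V - A) a)"
    using V by (auto simp: inj_on_def Y_def nbrs_def doubleton_eq_iff)
  moreover have "(\<lambda>(a, b). {a, b}) ` (SIGMA a:Y. nbrs E (V - A) a) \<subseteq> edge_cut E A"
    using V by (auto simp: Y_def nbrs_def edge_cut_def)
  moreover have "finite (edge_cut E A)"
    using simple_graph_finite[OF V(1,2)] by (simp add: edge_cut_def)
  ultimately have "card (SIGMA a:Y. nbrs E (V - A) a) \<le> card (edge_cut E A)"
    by (metis card_image card_mono)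
  then have "(\<Sum>a\<in>Y. card (nbrs E (V - A) a)) \<le> card (edge_cut E A)"
    using fin by (simp add: finite_nbrs)
  then have "(\<Sum>a\<in>Y. real (card (nbrs E (V - A) a))) \<le> real (card (edge_cut E A))"
    by (simp only: of_nat_le_iff of_nat_sum[symmetric])
  moreover have "(\<Sum>a\<in>Y. \<eta>) \<le> (\<Sum>a\<in>Y. real (card (nbrs E (V - A) a)))"
    by (rule sum_mono) (auto simp: Y_def light_def)
  ultimately have "\<eta> * real (card Y) \<le> \<eta> * (real (card X) / 2)"
    using c by (simp add: mult.commute)
  then have "real (card Y) \<le> real (card X) / 2" using \<eta> by simp
  moreover have "card Y = card X - card (light E (V - A) \<eta> X)"
    using fin unfolding Y_def by (intro card_Diff_subset) (auto simp: light_def)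
  ultimately show ?thesis by linarith
qed

lemma card_arcs_light:
  assumes V: "finite V" "simple_graph V E" "A \<subseteq> V" "X \<subseteq> A"
    and deg: "\<And>v. v \<in> X \<Longrightarrow> 4 * \<eta> \<le> real (vertex_degree E v)"
  shows "3 * \<eta> * real (card (light E (V - A) \<eta> X)) \<le> real (card (arcs E A (light E (V - A) \<eta> X)))"
proof -
  let ?L = "light E (V - A) \<eta> X"
  have fin: "finite A" "finite ?L"
    using V finite_subset[OF V(3)] finite_subset[OF V(4)] by (auto simp: light_def)
  have "3 * \<eta> \<le> real (card (nbrs E A a))" if "a \<in> ?L" for a
  proof -
    have "a \<in> X" "real (card (nbrs E (V - A) a)) \<le> \<eta>" using that by (auto simp: light_def)
    moreover have "vertex_degree E a = card (nbrs E A a) + card (nbrs E (V - A) a)"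
      using vertex_degree_eq_nbrs[OF V(2)] card_nbrs_split[OF V(1,3)] \<open>a \<in> X\<close> V by auto
    ultimately show ?thesis using deg[of a] by simp
  qed
  then have "(\<Sum>a\<in>?L. 3 * \<eta>) \<le> (\<Sum>a\<in>?L. real (card (nbrs E A a)))"
    by (rule sum_mono)
  then show ?thesis using fin by (simp add: arcs_def finite_nbrs mult.commute)
qed

text \<open>
  A pair of arcs \<open>(a, a')\<close>, \<open>(b, b')\<close> is blocked if \<open>{a, b'}\<close> is present already. For a fixed arc
  \<open>(a, a')\<close> there are at most \<open>\<eta>\<close> choices of \<open>b'\<close>, because \<open>a\<close> is light, and then at most \<open>|Y|\<close>
  choices of \<open>b\<close>, whatever the degree of \<open>b'\<close>. Since the vertices of \<open>Y\<close> start at least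
  \<open>3 \<eta>\<close> arcs on average, this is at most a third of all arcs \<open>(b, b')\<close>.
\<close>
lemma card_blocked:
  assumes fin: "finite P" "finite B"
    and nb: "\<And>a a'. (a, a') \<in> P \<Longrightarrow> real (card (nbrs E B a)) \<le> \<eta>"
    and Y: "finite Y" "3 * \<eta> * real (card Y) \<le> real (card (arcs E B Y))"
  shows "3 * real (card {((a, a'), (b, b')). (a, a') \<in> P \<and> (b, b') \<in> arcs E B Y \<and> {a, b'} \<in> E})
           \<le> real (card P) * real (card (arcs E B Y))"
proof -
  let ?Q = "\<lambda>x. {(b, b'). (b, b') \<in> arcs E B Y \<and> {fst x, b'} \<in> E}"
  have eq: "{((a, a'), (b, b')). (a, a') \<in> P \<and> (b, b') \<in> arcs E B Y \<and> {a, b'} \<in> E} = Sigma P ?Q"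
    by auto
  have sub: "?Q x \<subseteq> Y \<times> nbrs E B (fst x)" for x
    by (auto simp: arcs_def nbrs_def)
  have finQ: "finite (?Q x)" for x
    by (rule finite_subset[OF sub]) (simp add: Y fin finite_nbrs)
  have "3 * real (card (?Q x)) \<le> real (card (arcs E B Y))" if "x \<in> P" for x
  proof -
    have "card (?Q x) \<le> card Y * card (nbrs E B (fst x))"
      using card_mono[OF _ sub[of x]] Y fin by (simp add: finite_nbrs card_cartesian_product)
    then have "real (card (?Q x)) \<le> real (card Y) * real (card (nbrs E B (fst x)))"
      by (simp only: of_nat_le_iff of_nat_mult[symmetric])
    also have "\<dots> \<le> real (card Y) * \<eta>"
      using nb[of "fst x" "snd x"] that by (intro mult_left_mono) auto
    finally have "3 * real (card (?Q x)) \<le> 3 * \<eta> * real (card Y)" by (simp add: mult.commute)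
    then show ?thesis using Y(2) by (rule order_trans)
  qed
  then have "(\<Sum>x\<in>P. 3 * real (card (?Q x))) \<le> (\<Sum>x\<in>P. real (card (arcs E B Y)))"
    by (rule sum_mono)
  moreover have "card (Sigma P ?Q) = (\<Sum>x\<in>P. card (?Q x))"
    using fin finQ by (intro card_SigmaI) auto
  ultimately show ?thesis unfolding eq by (simp add: sum_distrib_left)
qed

definition switchings :: "'a set set \<Rightarrow> 'a set \<Rightarrow> 'a set \<Rightarrow> 'a set \<Rightarrow> 'a set \<Rightarrow> (('a \<times> 'a) \<times> ('a \<times> 'a)) set" where
  "switchings E A B X Y = {((a, a'), (b, b')). (a, a') \<in> arcs E A X \<and> (b, b') \<in> arcs E B Y
      \<and> {a, b'} \<notin> E \<and> {b, a'} \<notin> E}"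

text \<open>
  Both new edges have to be absent, which excludes at most a third of the pairs of arcs each, so a
  third of the pairs remain. Each of the two families has at least \<open>3 \<eta> \<cdot> m / 2\<close> arcs,
  and \<open>(3 \<eta> m / 2)\<^sup>2 / 3 = 3 / 4 \<cdot> (\<eta> m)\<^sup>2\<close>.
\<close>
lemma card_switchings:
  assumes V: "finite V" "simple_graph V E" "A \<subseteq> V" "X \<subseteq> A" "Y \<subseteq> V - A"
    and deg: "\<And>v. v \<in> X \<union> Y \<Longrightarrow> 4 * \<eta> \<le> real (vertex_degree E v)"
    and m: "m \<le> real (card X)" "m \<le> real (card Y)" "0 < m" and \<eta>: "0 < \<eta>"
    and c: "real (card (edge_cut E A)) \<le> \<eta> * m / 2"
  shows "3 / 4 * (\<eta> * m)\<^sup>2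
    \<le> real (card (switchings E A (V - A) (light E (V - A) \<eta> X) (light E A \<eta> Y)))"
proof -
  let ?B = "V - A"
  let ?X = "light E ?B \<eta> X" and ?Y = "light E A \<eta> Y"
  let ?P = "arcs E A ?X" and ?Q = "arcs E ?B ?Y"
  have VB: "V - ?B = A" using V by auto
  have fin: "finite A" "finite X" "finite Y" "finite ?B" "finite ?X" "finite ?Y"
    using V finite_subset[OF V(3)] finite_subset[OF V(4)] finite_subset[OF V(5)] by (auto simp: light_def)
  then have finPQ: "finite ?P" "finite ?Q" by (auto simp: arcs_def finite_nbrs)
  have cX: "real (card (edge_cut E A)) \<le> \<eta> * real (card X) / 2"
    using c m(1) \<eta> by (smt (verit) divide_right_mono mult_left_mono)
  have cY: "real (card (edge_cut E ?B)) \<le> \<eta> * real (card Y) / 2"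
    using c m(2) \<eta> edge_cut_Compl[OF V(2,3)] by (smt (verit) divide_right_mono mult_left_mono)
  have X: "m / 2 \<le> real (card ?X)" using card_light[OF V(1-4) cX \<eta>] m by simp
  have Y: "m / 2 \<le> real (card ?Y)"
    using card_light[OF V(1,2) _ V(5) cY \<eta>] m unfolding VB by simp
  have P: "3 * \<eta> * real (card ?X) \<le> real (card ?P)"
    using deg by (intro card_arcs_light V) auto
  have Q: "3 * \<eta> * real (card ?Y) \<le> real (card ?Q)"
    using card_arcs_light[OF V(1,2) _ V(5), of \<eta>] deg unfolding VB by auto
  let ?b1 = "{((a, a'), (b, b')). (a, a') \<in> ?P \<and> (b, b') \<in> ?Q \<and> {a, b'} \<in> E}"
  let ?b2 = "{((b, b'), (a, a')). (b, b') \<in> ?Q \<and> (a, a') \<in> ?P \<and> {b, a'} \<in> E}"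
  have b1: "3 * real (card ?b1) \<le> real (card ?P) * real (card ?Q)"
    by (rule card_blocked[OF finPQ(1) fin(4) _ fin(6) Q]) (auto simp: arcs_def light_def)
  have b2: "3 * real (card ?b2) \<le> real (card ?Q) * real (card ?P)"
    by (rule card_blocked[OF finPQ(2) fin(1) _ fin(5) P]) (auto simp: arcs_def light_def)
  \<comment> \<open>?b1 and ?b2 are the pairs of arcs blocked by the two edges that a switching would insert; ?b2 lists
    them in swapped order so that the same bound applies with the sides exchanged.\<close>
  have cover: "?P \<times> ?Q \<subseteq> switchings E A ?B ?X ?Y \<union> ?b1 \<union> prod.swap ` ?b2"
    by (auto simp: switchings_def image_iff)
  have "switchings E A ?B ?X ?Y \<subseteq> ?P \<times> ?Q" "?b1 \<subseteq> ?P \<times> ?Q" "?b2 \<subseteq> ?Q \<times> ?P"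
    by (auto simp: switchings_def)
  then have fins: "finite (switchings E A ?B ?X ?Y)" "finite ?b1" "finite ?b2"
    using finPQ by (meson finite_SigmaI finite_subset)+
  have "card (?P \<times> ?Q) \<le> card (switchings E A ?B ?X ?Y \<union> ?b1 \<union> prod.swap ` ?b2)"
    by (rule card_mono[OF _ cover]) (intro finite_UnI finite_imageI fins)
  also have "\<dots> \<le> card (switchings E A ?B ?X ?Y) + card ?b1 + card (prod.swap ` ?b2)"
    by (rule order_trans[OF card_Un_le add_right_mono[OF card_Un_le]])
  also have "card (prod.swap ` ?b2) = card ?b2"
    by (rule card_image) (auto simp: inj_on_def)
  finally have "real (card ?P) * real (card ?Q) \<le> real (card (switchings E A ?B ?X ?Y)) + real (card ?b1) + real (card ?b2)"
    by (simp only: card_cartesian_product of_nat_add[symmetric] of_nat_le_iff of_nat_mult[symmetric])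
  then have main: "real (card ?P) * real (card ?Q) \<le> 3 * real (card (switchings E A ?B ?X ?Y))"
    using b1 b2 by (simp add: mult.commute)
  have "3 * \<eta> * (m / 2) \<le> real (card ?P)" using P X \<eta> by (smt (verit) mult_left_mono)
  moreover have "3 * \<eta> * (m / 2) \<le> real (card ?Q)" using Q Y \<eta> by (smt (verit) mult_left_mono)
  ultimately have "(3 * \<eta> * (m / 2)) * (3 * \<eta> * (m / 2)) \<le> real (card ?P) * real (card ?Q)"
    using \<eta> m by (intro mult_mono) auto
  then show ?thesis using main by (simp add: power2_eq_square)
qed

section \<open>The switching argument for sparse cuts\<close>

definition switch :: "('a \<times> 'a) \<times> ('a \<times> 'a) \<Rightarrow> 'a set set \<Rightarrow> 'a set set" where
  "switch = (\<lambda>((a, a'), (b, b')) E. E - {{a, a'}, {b, b'}} \<union> {{a, b'}, {b, a'}})"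

text \<open>
  Stated for an arbitrary weight on edges so that it gives the effect of a switching on the degree of
  a vertex and on the size of a cut alike.
\<close>
lemma sum_switch:
  fixes f :: "'a set \<Rightarrow> nat"
  assumes E: "finite E" "{a, a'} \<in> E" "{b, b'} \<in> E" "{a, b'} \<notin> E" "{b, a'} \<notin> E"
    and ne: "{a, a'} \<noteq> {b, b'}" "{a, b'} \<noteq> {b, a'}"
  shows "sum f (switch ((a, a'), (b, b')) E) + f {a, a'} + f {b, b'} = sum f E + f {a, b'} + f {b, a'}"
proof -
  let ?F = "E - {{a, a'}, {b, b'}}"
  have "E = insert {a, a'} (insert {b, b'} ?F)" using E by auto
  then have "sum f E = sum f (insert {a, a'} (insert {b, b'} ?F))" by (rule arg_cong)
  also have "\<dots> = f {a, a'} + (f {b, b'} + sum f ?F)" using E ne by simp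
  finally have 1: "sum f E = f {a, a'} + (f {b, b'} + sum f ?F)" .
  have "switch ((a, a'), (b, b')) E = insert {a, b'} (insert {b, a'} ?F)"
    by (auto simp: switch_def)
  then have "sum f (switch ((a, a'), (b, b')) E) = sum f (insert {a, b'} (insert {b, a'} ?F))" by (rule arg_cong)
  also have "\<dots> = f {a, b'} + (f {b, a'} + sum f ?F)" using E ne by simp
  finally show ?thesis using 1 by simp
qed

lemma card_edge_cut_sum: "finite E \<Longrightarrow> card (edge_cut E A) = (\<Sum>e\<in>E. of_bool (e \<inter> A \<noteq> {} \<and> \<not> e \<subseteq> A))"
  by (simp only: edge_cut_def card_eq_sum sum.inter_filter of_bool_def)

lemma vertex_degree_sum: "finite E \<Longrightarrow> vertex_degree E v = (\<Sum>e\<in>E. of_bool (v \<in> e))"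
  by (simp only: vertex_degree_def card_eq_sum sum.inter_filter of_bool_def)

lemma switch_graph:
  assumes E: "E \<in> graphs_with_degrees n D" and A: "A \<subseteq> {1..n}" "X \<subseteq> A" "Y \<subseteq> {1..n} - A"
    and t: "\<tau> \<in> switchings E A ({1..n} - A) X Y"
  shows "switch \<tau> E \<in> graphs_with_degrees n D"
    and "card (edge_cut (switch \<tau> E) A) = card (edge_cut E A) + 2"
proof -
  obtain a a' b b' where \<tau>: "\<tau> = ((a, a'), (b, b'))" by (metis surj_pair)
  have sg: "simple_graph {1..n} E" using E by (simp add: graphs_with_degrees_def)
  have finE: "finite E" using simple_graph_finite[OF _ sg] by simp
  have mem: "a \<in> A" "a' \<in> A" "b \<in> {1..n} - A" "b' \<in> {1..n} - A" "{a, a'} \<in> E" "{b, b'} \<in> E"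
    "{a, b'} \<notin> E" "{b, a'} \<notin> E"
    using t A by (auto simp: \<tau> switchings_def arcs_def nbrs_def)
  have neq: "a \<noteq> a'" "b \<noteq> b'" using simple_graph_edgeD[OF sg] mem by auto
  have neq': "a \<noteq> b" "a \<noteq> b'" "a' \<noteq> b" "a' \<noteq> b'" using mem by auto
  have e: "{a, a'} \<noteq> {b, b'}" "{a, b'} \<noteq> {b, a'}" using neq neq' by (auto simp: doubleton_eq_iff)
  note ss = sum_switch[OF finE mem(5-8) e]
  have sg': "simple_graph {1..n} (switch \<tau> E)"
    using sg mem neq' A by (auto simp: simple_graph_def \<tau> switch_def)
  then have finE': "finite (switch \<tau> E)" using simple_graph_finite by blast
  have "vertex_degree (switch \<tau> E) v = vertex_degree E v" for v
    using ss[of "\<lambda>e. of_bool (v \<in> e)"] neq neq' unfolding \<tau> vertex_degree_sum[OF finE] vertex_degree_sum[OF finE'[unfolded \<tau>]]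
    by (auto simp: of_bool_def split: if_splits)
  then show "switch \<tau> E \<in> graphs_with_degrees n D"
    using E sg' by (simp add: graphs_with_degrees_def)
  show "card (edge_cut (switch \<tau> E) A) = card (edge_cut E A) + 2"
    using ss[of "\<lambda>e. of_bool (e \<inter> A \<noteq> {} \<and> \<not> e \<subseteq> A)"] mem(1-4)
    unfolding \<tau> card_edge_cut_sum[OF finE] card_edge_cut_sum[OF finE'[unfolded \<tau>]] by simp
qed

lemma switch_inj:
  assumes "\<tau> \<in> switchings E A B X Y" "\<tau> \<in> switchings F A B X' Y'" "switch \<tau> E = switch \<tau> F"
  shows "E = F"
proof -
  have "E = switch \<tau> E - {{a, b'}, {b, a'}} \<union> {{a, a'}, {b, b'}}"
    if "\<tau> = ((a, a'), (b, b'))" "\<tau> \<in> switchings E A B X Y" for E X Y a a' b b'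
    using that by (auto simp: switchings_def switch_def arcs_def nbrs_def)
  then show ?thesis using assms by (metis surj_pair)
qed

definition reverse_switchings :: "'a set set \<Rightarrow> 'a set \<Rightarrow> 'a set \<Rightarrow> (('a \<times> 'a) \<times> ('a \<times> 'a)) set" where
  "reverse_switchings E A B = {((a, a'), (b, b')). a \<in> A \<and> a' \<in> A \<and> b \<in> B \<and> b' \<in> B \<and> {a, b'} \<in> E \<and> {b, a'} \<in> E}"

text \<open>
  A switching that leads to a given graph is recovered from the two edges it inserted: they lie in the
  cut, and their ends in \<open>A\<close> and \<open>B\<close> are the four vertices.
\<close>
lemma card_reverse_switchings:
  assumes "finite E" "A \<inter> B = {}"
  shows "finite (reverse_switchings E A B)" "card (reverse_switchings E A B) \<le> (card (edge_cut E A))\<^sup>2"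
proof -
  let ?f = "\<lambda>((a, a'), (b, b')). ({a, b'}, {b, a'})"
  have inj: "inj_on ?f (reverse_switchings E A B)"
    using assms(2) by (auto simp: inj_on_def reverse_switchings_def doubleton_eq_iff)
  have sub: "?f ` reverse_switchings E A B \<subseteq> edge_cut E A \<times> edge_cut E A"
    using assms(2) by (auto simp: reverse_switchings_def edge_cut_def)
  have fin: "finite (edge_cut E A)" using assms(1) by (simp add: edge_cut_def)
  show "finite (reverse_switchings E A B)"
    using inj sub fin by (meson finite_SigmaI finite_imageD finite_subset)
  show "card (reverse_switchings E A B) \<le> (card (edge_cut E A))\<^sup>2"
    using card_inj_on_le[OF inj sub] fin by (simp add: power2_eq_square card_cartesian_product)
qed

text \<open>
  Double counting of the triples (graph, switching, result). A graph whose cut has at most \<open>t\<close> edges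
  admits at least \<open>3 / 4 \<cdot> (\<eta> m)\<^sup>2\<close> switchings, each of which adds two edges to the cut, while a graph
  with at most \<open>t + 2\<close> cut edges arises from at most \<open>(t + 2)\<^sup>2 \<le> (\<eta> m / 5)\<^sup>2\<close> of them. The ratio of
  the two bounds is \<open>75 / 4\<close>, which is at least \<open>16\<close>.
\<close>
lemma switching_step:
  fixes \<eta> m :: real
  assumes A: "A \<subseteq> {1..n}" "X \<subseteq> A" "Y \<subseteq> {1..n} - A"
    and deg: "\<And>v. v \<in> X \<union> Y \<Longrightarrow> 4 * \<eta> \<le> real (D v)"
    and m: "m \<le> real (card X)" "m \<le> real (card Y)" "0 < m" and \<eta>: "0 < \<eta>"
    and t: "real t + 2 \<le> \<eta> * m / 5"
  shows "16 * card {E \<in> graphs_with_degrees n D. card (edge_cut E A) \<le> t}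
           \<le> card {E \<in> graphs_with_degrees n D. card (edge_cut E A) \<le> t + 2}"
proof -
  let ?V = "{1..n}"
  let ?Q = "\<lambda>t. {E \<in> graphs_with_degrees n D. card (edge_cut E A) \<le> t}"
  let ?Z = "\<lambda>E. switchings E A (?V - A) (light E (?V - A) \<eta> X) (light E A \<eta> Y)"
  let ?R = "\<lambda>E. reverse_switchings E A (?V - A)"
  have finQ: "finite (?Q s)" for s using finite_graphs_with_degrees[of n D] by simp
  have sg: "simple_graph ?V E" if "E \<in> graphs_with_degrees n D" for E
    using that by (simp add: graphs_with_degrees_def)
  have finE: "finite E" if "E \<in> graphs_with_degrees n D" for E
    using simple_graph_finite[OF _ sg[OF that]] by simp
  have lower: "3 / 4 * (\<eta> * m)\<^sup>2 \<le> real (card (?Z E))" if "E \<in> ?Q t" for E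
  proof (rule card_switchings)
    show "4 * \<eta> \<le> real (vertex_degree E v)" if "v \<in> X \<union> Y" for v
    proof -
      have "v \<in> ?V" using that A by auto
      then have "vertex_degree E v = D v" using \<open>E \<in> ?Q t\<close> by (simp add: graphs_with_degrees_def)
      then show ?thesis using deg[OF that] by simp
    qed
    have "real (card (edge_cut E A)) \<le> real t" using that by simp
    then show "real (card (edge_cut E A)) \<le> \<eta> * m / 2" using t \<eta> m by simp
  qed (use sg that A m \<eta> in auto)
  have finZ: "finite (?Z E)" for E
  proof (rule finite_subset)
    show "?Z E \<subseteq> (?V \<times> ?V) \<times> (?V \<times> ?V)"
      using A by (auto simp: switchings_def arcs_def nbrs_def light_def)
  qed simp
  have R: "finite (?R E)" "real (card (?R E)) \<le> (real t + 2)\<^sup>2" if "E \<in> ?Q (t + 2)" for E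
  proof -
    have fE: "finite E" and le: "card (edge_cut E A) \<le> t + 2" using that finE by auto
    note r = card_reverse_switchings[OF fE, of A "?V - A"]
    show "finite (?R E)" using r(1) by auto
    have "card (?R E) \<le> (card (edge_cut E A))\<^sup>2" using r(2) by auto
    also have "\<dots> \<le> (t + 2)\<^sup>2" using le by (intro power_mono) auto
    finally have "real (card (?R E)) \<le> real ((t + 2)\<^sup>2)" by (rule of_nat_mono)
    then show "real (card (?R E)) \<le> (real t + 2)\<^sup>2" by (simp add: add.commute)
  qed
  have sw: "switch \<tau> E \<in> ?Q (t + 2)" "\<tau> \<in> ?R (switch \<tau> E)" if "E \<in> ?Q t" "\<tau> \<in> ?Z E" for E \<tau>
  proof -
    have lX: "light E (?V - A) \<eta> X \<subseteq> A" "light E A \<eta> Y \<subseteq> ?V - A"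
      using A by (auto simp: light_def)
    have E: "E \<in> graphs_with_degrees n D" using that by simp
    show "switch \<tau> E \<in> ?Q (t + 2)"
      using switch_graph[OF E A(1) lX that(2)] that(1) by simp
    show "\<tau> \<in> ?R (switch \<tau> E)"
      using that(2) lX by (auto simp: switchings_def reverse_switchings_def switch_def arcs_def nbrs_def)
  qed
  have "card (Sigma (?Q t) ?Z) \<le> card (Sigma (?Q (t + 2)) ?R)"
  proof (rule card_inj_on_le)
    show "inj_on (\<lambda>(E, \<tau>). (switch \<tau> E, \<tau>)) (Sigma (?Q t) ?Z)"
    proof (rule inj_onI)
      fix x y assume x: "x \<in> Sigma (?Q t) ?Z" and y: "y \<in> Sigma (?Q t) ?Z"
        and eq: "(\<lambda>(E, \<tau>). (switch \<tau> E, \<tau>)) x = (\<lambda>(E, \<tau>). (switch \<tau> E, \<tau>)) y"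
      obtain E \<tau> F \<sigma> where xy: "x = (E, \<tau>)" "y = (F, \<sigma>)" by (metis surj_pair)
      have s: "\<sigma> = \<tau>" "switch \<tau> E = switch \<tau> F" using eq unfolding xy by auto
      have "\<tau> \<in> ?Z E" "\<tau> \<in> ?Z F" using x y by (simp_all add: xy s(1))
      from switch_inj[OF this s(2)] show "x = y" by (simp add: xy s(1))
    qed
    show "(\<lambda>(E, \<tau>). (switch \<tau> E, \<tau>)) ` Sigma (?Q t) ?Z \<subseteq> Sigma (?Q (t + 2)) ?R"
    proof (rule image_subsetI)
      fix x assume x: "x \<in> Sigma (?Q t) ?Z"
      obtain E \<tau> where xy: "x = (E, \<tau>)" by (metis surj_pair)
      then have "E \<in> ?Q t" "\<tau> \<in> ?Z E" using x by simp_all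
      from sw[OF this] show "(\<lambda>(E, \<tau>). (switch \<tau> E, \<tau>)) x \<in> Sigma (?Q (t + 2)) ?R"
        unfolding xy prod.case by (rule SigmaI)
    qed
    show "finite (Sigma (?Q (t + 2)) ?R)" by (rule finite_SigmaI[OF finQ R(1)])
  qed
  moreover have "card (Sigma (?Q t) ?Z) = (\<Sum>E\<in>?Q t. card (?Z E))"
    by (intro card_SigmaI ballI finQ finZ)
  moreover have "card (Sigma (?Q (t + 2)) ?R) = (\<Sum>E\<in>?Q (t + 2). card (?R E))"
    by (intro card_SigmaI ballI finQ R(1))
  ultimately have "(\<Sum>E\<in>?Q t. card (?Z E)) \<le> (\<Sum>E\<in>?Q (t + 2). card (?R E))"
    by (simp only:)
  then have "(\<Sum>E\<in>?Q t. real (card (?Z E))) \<le> (\<Sum>E\<in>?Q (t + 2). real (card (?R E)))"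
    by (simp only: of_nat_le_iff of_nat_sum[symmetric])
  moreover have "(\<Sum>E\<in>?Q t. 3 / 4 * (\<eta> * m)\<^sup>2) \<le> (\<Sum>E\<in>?Q t. real (card (?Z E)))"
    by (rule sum_mono[OF lower])
  moreover have "(\<Sum>E\<in>?Q (t + 2). real (card (?R E))) \<le> (\<Sum>E\<in>?Q (t + 2). (real t + 2)\<^sup>2)"
    by (rule sum_mono[OF R(2)])
  ultimately have "real (card (?Q t)) * (3 / 4 * (\<eta> * m)\<^sup>2) \<le> real (card (?Q (t + 2))) * (real t + 2)\<^sup>2"
    by (simp only: sum_constant)
  also have "\<dots> \<le> real (card (?Q (t + 2))) * (\<eta> * m / 5)\<^sup>2"
    using t by (intro mult_left_mono power_mono) auto
  finally have "(\<eta> * m)\<^sup>2 * (real (card (?Q t)) * (3 / 4)) \<le> (\<eta> * m)\<^sup>2 * (real (card (?Q (t + 2))) / 25)"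
    by (simp add: power_divide algebra_simps)
  then have "real (card (?Q t)) * (3 / 4) \<le> real (card (?Q (t + 2))) / 25"
    using \<eta> m by (simp del: of_nat_add)
  then have "16 * real (card (?Q t)) \<le> real (card (?Q (t + 2)))" by linarith
  then show ?thesis by linarith
qed

text \<open>
  Each of \<open>k\<close> consecutive switching steps gains a factor \<open>16\<close>. With \<open>k = n\<close> the bound beats the number
  \<open>2\<^sup>n\<close> of cuts.
\<close>
lemma sparse_cut_prob:
  fixes \<eta> m :: real
  assumes A: "A \<subseteq> {1..n}" "X \<subseteq> A" "Y \<subseteq> {1..n} - A"
    and deg: "\<And>v. v \<in> X \<union> Y \<Longrightarrow> 4 * \<eta> \<le> real (D v)"
    and m: "m \<le> real (card X)" "m \<le> real (card Y)" "0 < m" and \<eta>: "0 < \<eta>"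
    and t: "real t + 2 * real k \<le> \<eta> * m / 5"
    and feas: "feasible n D"
  shows "measure_pmf.prob (random_graph n D) {E. card (edge_cut E A) \<le> t} \<le> 1 / 16 ^ k"
proof -
  let ?G = "graphs_with_degrees n D"
  let ?Q = "\<lambda>t. {E \<in> ?G. card (edge_cut E A) \<le> t}"
  have fin: "finite ?G" and ne: "?G \<noteq> {}"
    using finite_graphs_with_degrees feas feasible_iff by auto
  have "16 ^ k * card (?Q t) \<le> card (?Q (t + 2 * k))" using t
  proof (induction k)
    case (Suc k)
    have "16 ^ Suc k * card (?Q t) \<le> 16 * card (?Q (t + 2 * k))" using Suc by simp
    also have "\<dots> \<le> card (?Q (t + 2 * k + 2))"
      using Suc.prems by (intro switching_step[OF A deg m \<eta>]) auto
    finally show ?case by simp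
  qed simp
  also have "\<dots> \<le> card ?G" using fin by (intro card_mono) auto
  finally have "real (16 ^ k * card (?Q t)) \<le> real (card ?G)" by (rule of_nat_mono)
  then have "16 ^ k * real (card (?Q t)) \<le> real (card ?G)" by simp
  moreover have "measure_pmf.prob (random_graph n D) {E. card (edge_cut E A) \<le> t} = card (?Q t) / card ?G"
    unfolding random_graph_def measure_pmf_of_set[OF ne fin] by (simp add: Int_def)
  moreover have "0 < card ?G" using fin ne by (simp add: card_gt_0_iff)
  ultimately show ?thesis by (simp only: pos_divide_le_eq of_nat_0_less_iff) (simp add: field_simps)
qed

section \<open>The largest component between cuts and isolated vertices\<close>

definition reachable :: "'a set \<Rightarrow> 'a set set \<Rightarrow> ('a \<times> 'a) set" where
  "reachable V E = {(u, v) \<in> V \<times> V. (u, v) \<in> {(x, y). {x, y} \<in> E}\<^sup>*}"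

definition nonisolated :: "'a set \<Rightarrow> 'a set set \<Rightarrow> 'a set" where
  "nonisolated V E = {v \<in> V. \<exists>e\<in>E. v \<in> e}"

lemma graph_components_eq: "graph_components V E = V // reachable V E"
  by (simp add: graph_components_def reachable_def)

lemma equiv_reachable: "equiv V (reachable V E)"
proof (rule equivI)
  have "sym {(x, y). {x, y} \<in> E}" by (auto simp: sym_def insert_commute)
  then have "sym ({(x, y). {x, y} \<in> E}\<^sup>*)" by (rule sym_rtrancl)
  then show "sym (reachable V E)" by (auto simp: reachable_def sym_def)
  show "trans (reachable V E)" by (auto simp: reachable_def trans_def)
qed (auto simp: reachable_def refl_on_def)

lemma finite_graph_components: "finite V \<Longrightarrow> finite (graph_components V E)"
  unfolding graph_components_eq by (rule finite_quotient) (auto simp: reachable_def)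

lemma card_component_le_L1: "finite V \<Longrightarrow> C \<in> graph_components V E \<Longrightarrow> card C \<le> L1 V E"
  unfolding L1_def by (intro Max_ge finite_imageI finite_graph_components) auto

lemma L1_le_nonisolated:
  assumes "finite V" "V \<noteq> {}"
  shows "L1 V E \<le> 1 + card (nonisolated V E)"
proof -
  have "graph_components V E \<noteq> {}" using assms by (auto simp: graph_components_eq quotient_def)
  then have "L1 V E \<in> card ` graph_components V E"
    unfolding L1_def using assms by (intro Max_in finite_imageI finite_graph_components) auto
  then obtain v where L: "L1 V E = card (reachable V E `` {v})"
    by (auto simp: graph_components_eq quotient_def)
  have "reachable V E `` {v} \<subseteq> insert v (nonisolated V E)"
  proof
    fix u assume "u \<in> reachable V E `` {v}"
    then have "u \<in> V" "(v, u) \<in> {(x, y). {x, y} \<in> E}\<^sup>*" by (auto simp: reachable_def)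
    from this(2) show "u \<in> insert v (nonisolated V E)"
    proof (cases rule: rtranclE)
      case (step y)
      then have "{y, u} \<in> E" by simp
      then show ?thesis using \<open>u \<in> V\<close> unfolding nonisolated_def by blast
    qed simp
  qed
  moreover have fin: "finite (nonisolated V E)" using assms by (simp add: nonisolated_def)
  ultimately have "L1 V E \<le> card (insert v (nonisolated V E))" unfolding L by (intro card_mono) auto
  also have "\<dots> \<le> 1 + card (nonisolated V E)" using fin by (simp add: card_insert_if)
  finally show ?thesis .
qed

lemma edge_cut_component:
  assumes "simple_graph V E" "C \<in> graph_components V E"
  shows "edge_cut E C = {}"
proof (rule ccontr)
  assume "edge_cut E C \<noteq> {}"
  then obtain e where e: "e \<in> E" "e \<inter> C \<noteq> {}" "\<not> e \<subseteq> C" by (auto simp: edge_cut_def)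
  then have "card e = 2" "e \<subseteq> V" using assms(1) by (auto simp: simple_graph_def)
  from e obtain x y where xy: "x \<in> e" "y \<in> e" "x \<in> C" "y \<notin> C" by blast
  have "finite e" using \<open>card e = 2\<close> card.infinite by fastforce
  moreover have "card {x, y} = card e" using \<open>card e = 2\<close> xy(3,4) by (cases "x = y") auto
  ultimately have "{x, y} = e" using xy by (intro card_subset_eq) auto
  then have "(x, y) \<in> reachable V E" using e(1) xy \<open>e \<subseteq> V\<close> by (auto simp: reachable_def)
  with in_quotient_imp_closed[OF equiv_reachable assms(2)[unfolded graph_components_eq] xy(3)] xy(4)
  show False by simp
qed

lemma edge_cut_Diff:
  assumes "edge_cut E A = {}" "edge_cut E C = {}" "C \<subseteq> A"
  shows "edge_cut E (A - C) = {}"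
  using assms unfolding edge_cut_def by blast

text \<open>
  Let \<open>|H| > 3 m\<close>, and take a smallest union \<open>A\<close> of components with at least \<open>m\<close> vertices of \<open>H\<close>.
  Fewer than \<open>m\<close> vertices of \<open>H\<close> lie outside \<open>A\<close>, since otherwise \<open>A\<close> would be a forbidden empty cut. If \<open>A\<close> is a
  single component, that component is as large as claimed. If not, \<open>A\<close> splits into two smaller unions
  of components with fewer than \<open>m\<close> vertices of \<open>H\<close> each, a contradiction.
\<close>
lemma L1_ge_of_no_empty_cut:
  fixes m :: real
  assumes V: "finite V" "simple_graph V E" "H \<subseteq> V"
    and cut: "\<And>A. A \<subseteq> V \<Longrightarrow> m \<le> real (card (A \<inter> H)) \<Longrightarrow> m \<le> real (card (H - A)) \<Longrightarrow> edge_cut E A \<noteq> {}"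
    and m: "0 < m"
  shows "real (card H) \<le> real (L1 V E) + 3 * m"
proof (cases "real (card H) \<le> 3 * m")
  case True
  then show ?thesis by simp
next
  case big: False
  have finH: "finite H" using V finite_subset by blast
  have split: "real (card (A \<inter> H)) + real (card (H - A)) = real (card H)" for A
    using card_Int_Diff[OF finH, of A] by (simp add: Int_commute)
  \<comment> \<open>Unions of components are exactly the vertex sets with empty edge cut.\<close>
  let ?P = "\<lambda>A. A \<subseteq> V \<and> edge_cut E A = {} \<and> m \<le> real (card (A \<inter> H))"
  have "?P V"
    using V big m by (auto simp: edge_cut_def simple_graph_def Int_absorb1)
  then obtain A where A: "?P A" and min: "\<And>B. ?P B \<Longrightarrow> card A \<le> card B"
    using ex_has_least_nat[of ?P V card] by blast
  have finA: "finite A" using A V finite_subset by blast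
  have rest: "real (card (H - A)) < m" using A cut[of A] by (metis not_le)
  have "A \<noteq> {}" using A m by (cases "A = {}") simp_all
  then obtain v where v: "v \<in> A" by blast
  define C where "C = reachable V E `` {v}"
  have C: "C \<in> graph_components V E" "v \<in> C"
    using v A quotientI[of v V "reachable V E"] by (auto simp: C_def graph_components_eq) (auto simp: reachable_def)
  have cutC: "edge_cut E C = {}" by (rule edge_cut_component[OF V(2) C(1)])
  have "C \<subseteq> A"
  proof
    fix u assume "u \<in> C"
    then have "(v, u) \<in> {(x, y). {x, y} \<in> E}\<^sup>*" by (auto simp: C_def reachable_def)
    then show "u \<in> A"
    proof induction
      case (step x y)
      then have "{x, y} \<in> E" by simp
      moreover have "edge_cut E A = {}" using A by simp
      ultimately show ?case using step.IH by (auto simp: edge_cut_def)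
    qed (rule v)
  qed
  show ?thesis
  proof (cases "C = A")
    case True
    have "card (A \<inter> H) \<le> card A" using finA by (intro card_mono) auto
    also have "\<dots> \<le> L1 V E" using card_component_le_L1[OF V(1) C(1)] True by simp
    finally show ?thesis using split[of A] rest m by simp
  next
    case False
    have small: "real (card (B \<inter> H)) < m" if "B \<subset> A" "edge_cut E B = {}" for B
      using min[of B] psubset_card_mono[OF finA that(1)] that A by (meson leD not_le_imp_less order_trans psubset_imp_subset)
    have "real (card (C \<inter> H)) < m" using small[of C] \<open>C \<subseteq> A\<close> False cutC by blast
    moreover have "real (card ((A - C) \<inter> H)) < m"
      using small[of "A - C"] C v edge_cut_Diff[OF _ cutC \<open>C \<subseteq> A\<close>] A by blast
    moreover have "card (A \<inter> H) \<le> card (C \<inter> H) + card ((A - C) \<inter> H)"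
    proof -
      have "A \<inter> H = (C \<inter> H) \<union> ((A - C) \<inter> H)" using \<open>C \<subseteq> A\<close> by blast
      then show ?thesis by (metis card_Un_le)
    qed
    ultimately have False using split[of A] rest big by linarith
    then show ?thesis ..
  qed
qed

section \<open>Probabilities in the two-stage percolation\<close>

lemma prob_percolate_cut:
  assumes "finite E" "0 \<le> p" "p \<le> 1"
  shows "measure_pmf.prob (percolate p E) {F. edge_cut F A = {}} = (1 - p) ^ card (edge_cut E A)"
proof -
  let ?B = "\<lambda>e. if e \<in> edge_cut E A then {False} else UNIV"
  let ?M = "Pi_pmf E False (\<lambda>_. bernoulli_pmf p)"
  have "measure_pmf.prob (percolate p E) {F. edge_cut F A = {}} = measure_pmf.prob ?M (Pi E ?B)"
    unfolding percolate_def by (auto simp: edge_cut_def Pi_def intro!: arg_cong[where f="measure_pmf.prob ?M"])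
  also have "\<dots> = (\<Prod>e\<in>E. measure_pmf.prob (bernoulli_pmf p) (?B e))"
    by (rule measure_Pi_pmf_Pi[OF assms(1)])
  also have "\<dots> = (\<Prod>e\<in>E. if e \<in> edge_cut E A then 1 - p else 1)"
    using assms by (intro prod.cong) (auto simp: measure_pmf_single)
  also have "\<dots> = (1 - p) ^ card (edge_cut E A)"
    using assms(1) by (simp add: prod.If_cases edge_cut_def Int_def cong: conj_cong)
  finally show ?thesis .
qed

lemma prob_percolate_edge:
  assumes "finite E" "e \<in> E" "0 \<le> p" "p \<le> 1"
  shows "measure_pmf.prob (percolate p E) {F. e \<in> F} = p"
proof -
  let ?M = "Pi_pmf E False (\<lambda>_. bernoulli_pmf p)"
  have "measure_pmf.prob (percolate p E) {F. e \<in> F} = measure_pmf.prob (map_pmf (\<lambda>X. X e) ?M) {True}"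
    unfolding percolate_def using assms by (simp add: vimage_def)
  also have "\<dots> = p" using assms by (simp add: Pi_pmf_component measure_pmf_single)
  finally show ?thesis .
qed

lemma set_percolate: "F \<in> set_pmf (percolate p E) \<Longrightarrow> F \<subseteq> E"
  by (auto simp: percolate_def)

text \<open>
  Outside the exceptional set \<open>B\<close> of first outcomes the conditional probability is at most \<open>c\<close>. The
  factor \<open>1 - prob p B\<close> is kept because for percolation in two stages it makes the bound add up to
  \<open>p2\<close> exactly.
\<close>
lemma prob_bind_le:
  assumes c: "\<And>x. x \<in> set_pmf p \<Longrightarrow> x \<notin> B \<Longrightarrow> measure_pmf.prob (f x) X \<le> c" and "0 \<le> c"
  shows "measure_pmf.prob (bind_pmf p f) X \<le> measure_pmf.prob p B + c * (1 - measure_pmf.prob p B)"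
proof -
  have int: "integrable (measure_pmf p) (indicat_real B)"
    by (rule measure_pmf.integrable_const_bound[where B=1]) auto
  have "measure_pmf.prob (bind_pmf p f) X = measure_pmf.expectation p (\<lambda>x. measure_pmf.prob (f x) X)"
    by (simp add: measure_pmf_bind measure_pmf.measure_bind[where N="count_space UNIV"] measurable_def space_subprob_algebra subprob_space_measure_pmf)
  also have "\<dots> \<le> measure_pmf.expectation p (\<lambda>x. c + (1 - c) * indicator B x)"
  proof (rule integral_mono_AE)
    show "integrable (measure_pmf p) (\<lambda>x. measure_pmf.prob (f x) X)"
      by (rule measure_pmf.integrable_const_bound[where B=1]) auto
    show "AE x in measure_pmf p. measure_pmf.prob (f x) X \<le> c + (1 - c) * indicator B x"
      using c by (auto simp: AE_measure_pmf_iff indicator_def)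
  qed (use int in auto)
  also have "\<dots> = c + (1 - c) * measure_pmf.prob p B"
    using int by simp
  finally show ?thesis by (simp add: algebra_simps)
qed

lemma fst_percolation_coupling: "map_pmf fst (percolation_coupling p1 p2 E) = percolate p1 E"
  by (simp add: percolation_coupling_def map_bind_pmf map_pmf_comp map_pmf_const bind_return_pmf')

lemma prob_coupling_cut:
  assumes "finite E" "0 \<le> p1" "p1 \<le> 1"
  shows "measure_pmf.prob (percolation_coupling p1 p2 E) {(G1, G2). edge_cut G1 A = {}} = (1 - p1) ^ card (edge_cut E A)"
proof -
  have eq: "{(G1, G2). edge_cut G1 A = {}} = fst -` {F. edge_cut F A = {}}" by auto
  have "measure_pmf.prob (percolation_coupling p1 p2 E) {(G1, G2). edge_cut G1 A = {}}
     = measure_pmf.prob (map_pmf fst (percolation_coupling p1 p2 E)) {F. edge_cut F A = {}}"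
    by (simp only: measure_map_pmf eq)
  then show ?thesis using prob_percolate_cut[OF assms] by (simp only: fst_percolation_coupling)
qed

text \<open>
  An edge survives the first stage with probability \<open>p1\<close> and is otherwise rescued with
  probability \<open>(p2 - p1) / (1 - p1)\<close>; the total is \<open>p2\<close>.
\<close>
lemma prob_coupling_edge:
  assumes E: "finite E" "e \<in> E" and p: "0 \<le> p1" "p1 \<le> p2" "p2 \<le> 1"
  shows "measure_pmf.prob (percolation_coupling p1 p2 E) {(G1, G2). e \<in> G2} \<le> p2"
proof -
  let ?q = "(p2 - p1) / (1 - p1)"
  have q: "0 \<le> ?q" "?q \<le> 1" using p by (auto simp: divide_le_eq)
  have pe: "measure_pmf.prob (percolate p1 E) {F. e \<in> F} = p1"
    using E p by (intro prob_percolate_edge) auto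
  have "measure_pmf.prob (percolation_coupling p1 p2 E) {(G1, G2). e \<in> G2} \<le> p1 + ?q * (1 - p1)"
    unfolding percolation_coupling_def
  proof (rule order_trans[OF prob_bind_le[where B="{F. e \<in> F}" and c="?q"]])
    fix A assume A: "A \<in> set_pmf (percolate p1 E)" "A \<notin> {F. e \<in> F}"
    have "measure_pmf.prob (map_pmf (\<lambda>B. (A, A \<union> B)) (percolate ?q (E - A))) {(G1, G2). e \<in> G2}
      = measure_pmf.prob (percolate ?q (E - A)) {F. e \<in> F}"
      using A by (simp add: vimage_def)
    also have "\<dots> = ?q" using E A q by (intro prob_percolate_edge) auto
    finally show "measure_pmf.prob (map_pmf (\<lambda>B. (A, A \<union> B)) (percolate ?q (E - A))) {(G1, G2). e \<in> G2} \<le> ?q" by simp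
  qed (use q pe in auto)
  \<comment> \<open>For p1 = 1 the quotient is 0, and p2 = 1 as well.\<close>
  also have "\<dots> \<le> p2" using p by (cases "p1 = 1") auto
  finally show ?thesis .
qed

lemma set_percolation_coupling:
  "(G1, G2) \<in> set_pmf (percolation_coupling p1 p2 E) \<Longrightarrow> G1 \<subseteq> E \<and> G2 \<subseteq> E"
  by (auto simp: percolation_coupling_def dest!: set_percolate)

lemma prob_coupling_nonisolated:
  assumes E: "finite E" and p: "0 \<le> p1" "p1 \<le> p2" "p2 \<le> 1"
  shows "measure_pmf.prob (percolation_coupling p1 p2 E) {(G1, G2). v \<in> nonisolated V G2} \<le> real (vertex_degree E v) * p2"
proof -
  let ?M = "percolation_coupling p1 p2 E"
  have "measure_pmf.prob ?M {(G1, G2). v \<in> nonisolated V G2}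
     = measure_pmf.prob ?M ({(G1, G2). v \<in> nonisolated V G2} \<inter> set_pmf ?M)"
    by (simp add: measure_Int_set_pmf)
  also have "\<dots> \<le> measure_pmf.prob ?M (\<Union>e\<in>{e \<in> E. v \<in> e}. {(G1, G2). e \<in> G2})"
    by (rule measure_pmf.finite_measure_mono)
       (auto simp: nonisolated_def dest!: set_percolation_coupling)
  also have "\<dots> \<le> (\<Sum>e\<in>{e \<in> E. v \<in> e}. measure_pmf.prob ?M {(G1, G2). e \<in> G2})"
    using E by (intro measure_pmf.finite_measure_subadditive_finite) auto
  also have "\<dots> \<le> (\<Sum>e\<in>{e \<in> E. v \<in> e}. p2)"
    using E p by (intro sum_mono prob_coupling_edge) auto
  finally show ?thesis by (simp add: vertex_degree_def)
qed

text \<open>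
  Markov's inequality for the number of elements of \<open>L\<close> that the random set \<open>N\<close> hits.
\<close>
lemma prob_card_ge:
  assumes L: "finite L" and c: "\<And>v. v \<in> L \<Longrightarrow> measure_pmf.prob M {x. v \<in> N x} \<le> c" and s: "0 < s"
  shows "measure_pmf.prob M {x. s \<le> real (card (L \<inter> N x))} \<le> real (card L) * c / s"
proof -
  have eq: "real (card (L \<inter> N x)) = (\<Sum>v\<in>L. indicat_real {x. v \<in> N x} x)" for x
    using L by (simp add: indicator_def sum.If_cases Int_def)
  have int: "integrable (measure_pmf M) (indicat_real {x. v \<in> N x})" for v
    by (rule measure_pmf.integrable_const_bound[where B=1]) auto
  have "measure_pmf.prob M {x. s \<le> real (card (L \<inter> N x))} \<le> measure_pmf.expectation M (\<lambda>x. real (card (L \<inter> N x))) / s"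
    using integral_Markov_inequality_measure[where M="measure_pmf M" and A="{}" and c=s and u="\<lambda>x. real (card (L \<inter> N x))"] s int
    by (simp add: eq sum_nonneg)
  also have "measure_pmf.expectation M (\<lambda>x. real (card (L \<inter> N x))) = (\<Sum>v\<in>L. measure_pmf.prob M {x. v \<in> N x})"
    unfolding eq using int by (simp add: Bochner_Integration.integral_sum)
  also have "\<dots> / s \<le> (\<Sum>v\<in>L. c) / s"
    using s c by (intro divide_right_mono sum_mono) auto
  finally show ?thesis by simp
qed

section \<open>Comparison of the two percolations\<close>

text \<open>
  Either the cut has at most \<open>2 n d\<close> edges in the random graph, which has probability at most
  \<open>1 / 16\<^sup>n\<close> by the switching argument, or all of its more than \<open>2 n d\<close> edges have to be deleted,
  which has probability at most \<open>(1 - 1 / d) powr (2 n d) \<le> exp (- 2 n) \<le> 1 / 4\<^sup>n\<close>. The parameter \<open>r\<close>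
  stands for \<open>\<surd>\<omega>\<close>.
\<close>
lemma prob_empty_cut_le:
  fixes d p1 p2 r :: real
  assumes feas: "feasible n D" and A: "A \<subseteq> {1..n}" and d: "1 \<le> d" and n: "1 \<le> n" and p1: "p1 = 1 / d"
    and r: "80 \<le> r"
    and H: "real n / r \<le> real (card (A \<inter> S n D (r\<^sup>2 * d)))" "real n / r \<le> real (card (S n D (r\<^sup>2 * d) - A))"
  shows "measure_pmf.prob (bind_pmf (random_graph n D) (percolation_coupling p1 p2))
           {(G1, G2). edge_cut G1 A = {}} \<le> 2 / 4 ^ n"
proof -
  let ?H = "S n D (r\<^sup>2 * d)"
  define t where "t = nat \<lfloor>2 * real n * d\<rfloor>"
  let ?B = "{E. card (edge_cut E A) \<le> t}"
  have t0: "0 \<le> 2 * real n * d" using d by simp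
  have t: "real t \<le> 2 * real n * d" "2 * real n * d < real t + 1"
    unfolding t_def using t0 by linarith+
  have sparse: "measure_pmf.prob (random_graph n D) ?B \<le> 1 / 16 ^ n"
  proof (rule sparse_cut_prob[where \<eta>="r\<^sup>2 * d / 4" and m="real n / r" and X="A \<inter> ?H" and Y="?H - A"])
    \<comment> \<open>The n switching steps lead from t up to at most 4 n d crossing edges, and the bound r n d / 20
      up to which they are possible is no smaller because r is at least 80.\<close>
    have "real n * 1 \<le> real n * d" using d by (intro mult_left_mono) auto
    then have "real t + 2 * real n \<le> 4 * real n * d" using t by linarith
    also have "\<dots> = 80 * (real n * d) / 20" by simp
    also have "\<dots> \<le> r * (real n * d) / 20"
      using r d by (intro divide_right_mono mult_right_mono) auto
    also have "\<dots> = r\<^sup>2 * d / 4 * (real n / r) / 5"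
      using r by (simp add: field_simps power2_eq_square)
    finally show "real t + 2 * real n \<le> r\<^sup>2 * d / 4 * (real n / r) / 5" .
  qed (use A H r n d feas in \<open>auto simp: S_def\<close>)
  have dense: "measure_pmf.prob (percolation_coupling p1 p2 E) {(G1, G2). edge_cut G1 A = {}} \<le> 1 / 4 ^ n"
    if E: "E \<in> set_pmf (random_graph n D)" "E \<notin> ?B" for E
  proof -
    have "E \<in> graphs_with_degrees n D"
      using E(1) feas finite_graphs_with_degrees by (simp add: random_graph_def feasible_iff)
    then have "finite E" using simple_graph_finite[of "{1..n}" E] by (simp add: graphs_with_degrees_def)
    then have "measure_pmf.prob (percolation_coupling p1 p2 E) {(G1, G2). edge_cut G1 A = {}}
       = (1 - 1 / d) ^ card (edge_cut E A)"
      using d unfolding p1 by (intro prob_coupling_cut) auto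
    also have "\<dots> \<le> exp (- (1 / d)) ^ card (edge_cut E A)"
      using d exp_ge_add_one_self[of "- (1 / d)"] by (intro power_mono) auto
    also have "\<dots> = exp (- (real (card (edge_cut E A)) / d))"
      by (simp add: exp_of_nat_mult[symmetric])
    also have "\<dots> \<le> exp (- (2 * real n))"
    proof -
      have "2 * real n * d \<le> real (card (edge_cut E A))" using t E(2) by (simp add: not_le)
      then show ?thesis using d by (simp add: le_divide_eq)
    qed
    also have "\<dots> = 1 / (exp 1 ^ 2) ^ n"
      by (simp add: exp_minus exp_of_nat_mult[symmetric] power_mult[symmetric] divide_inverse mult.commute)
    also have "\<dots> \<le> 1 / (2 ^ 2) ^ n"
      using exp_ge_add_one_self[of 1] by (intro divide_left_mono power_mono) auto
    finally show ?thesis by simp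
  qed
  have "measure_pmf.prob (bind_pmf (random_graph n D) (percolation_coupling p1 p2)) {(G1, G2). edge_cut G1 A = {}}
     \<le> measure_pmf.prob (random_graph n D) ?B + 1 / 4 ^ n * (1 - measure_pmf.prob (random_graph n D) ?B)"
    by (rule prob_bind_le[OF dense]) auto
  also have "\<dots> \<le> 1 / 16 ^ n + 1 / 4 ^ n * 1"
    using sparse by (intro add_mono mult_left_mono) auto
  also have "\<dots> \<le> 1 / 4 ^ n + 1 / 4 ^ n * (1::real)"
    by (intro add_mono divide_left_mono power_mono) auto
  finally show ?thesis by simp
qed

text \<open>
  The theorem with explicit errors. Two bad events are excluded: some cut that leaves \<open>n / r\<close> high
  vertices on both sides is empty after the first percolation (a union bound over at most \<open>2\<^sup>n\<close> cuts),
  or at least \<open>n / r\<close> low vertices keep an edge in the second (Markov, each does so with probability at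
  most \<open>1 / r\<^sup>2\<close>). With \<open>r = \<surd>\<omega>\<close> the threshold \<open>n / r\<close> is small compared with \<open>n\<close> and
  yet large compared with \<open>n / \<omega>\<close>, which both events require.
\<close>
lemma L1_gap_prob:
  fixes d1 d2 p1 p2 r :: real
  assumes feas: "feasible n D" and d: "1 \<le> d2" "d2 \<le> d1" and n: "1 \<le> n"
    and p: "p1 = 1 / d1" "p2 = 1 / d2" and r: "80 \<le> r"
  defines "J \<equiv> bind_pmf (random_graph n D) (percolation_coupling p1 p2)"
    and "M \<equiv> S n D (inverse (r\<^sup>2) * d2) - S n D (r\<^sup>2 * d1)"
  shows "1 - (2 / 2 ^ n + 1 / r) \<le> measure_pmf.prob J
    {(G1, G2). real (L1 {1..n} G2) - real (L1 {1..n} G1) \<le> real (card M) + 4 * real n / r + 1}"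
    (is "_ \<le> measure_pmf.prob J ?Good")
proof -
  let ?V = "{1..n}"
  define H where "H = S n D (r\<^sup>2 * d1)"
  define L where "L = ?V - S n D (inverse (r\<^sup>2) * d2)"
  define Cuts where "Cuts = {A. A \<subseteq> ?V \<and> real n / r \<le> real (card (A \<inter> H)) \<and> real n / r \<le> real (card (H - A))}"
  define B1 where "B1 = (\<Union>A\<in>Cuts. {(G1, G2 :: nat set set). edge_cut G1 A = {}})"
  define B2 where "B2 = {x :: nat set set \<times> nat set set. real n / r \<le> real (card (L \<inter> nonisolated ?V (snd x)))}"
  have r0: "0 < real n / r" using n r by simp
  have sub: "H \<subseteq> ?V" "M \<subseteq> ?V" "L \<subseteq> ?V" "?V \<subseteq> H \<union> M \<union> L"
    by (auto simp: H_def M_def L_def S_def)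
  have fin: "finite H" "finite M" "finite L" using sub finite_subset[of _ ?V] by auto
  have graph: "simple_graph ?V E" "finite E" "\<And>v. v \<in> ?V \<Longrightarrow> vertex_degree E v = D v"
    if "E \<in> set_pmf (random_graph n D)" for E
  proof -
    have "E \<in> graphs_with_degrees n D"
      using that feas finite_graphs_with_degrees by (simp add: random_graph_def feasible_iff)
    then show "simple_graph ?V E" "\<And>v. v \<in> ?V \<Longrightarrow> vertex_degree E v = D v"
      by (simp_all add: graphs_with_degrees_def)
    then show "finite E" using simple_graph_finite by blast
  qed
  have B1: "measure_pmf.prob J B1 \<le> 2 / 2 ^ n"
  proof -
    have "Cuts \<subseteq> Pow ?V" by (auto simp: Cuts_def)
    then have Cuts: "finite Cuts" "card Cuts \<le> 2 ^ n"
      using card_mono[of "Pow ?V" Cuts] by (auto simp: card_Pow intro: finite_subset)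
    have "measure_pmf.prob J B1 \<le> (\<Sum>A\<in>Cuts. measure_pmf.prob J {(G1, G2). edge_cut G1 A = {}})"
      unfolding B1_def using Cuts by (intro measure_pmf.finite_measure_subadditive_finite) auto
    also have "\<dots> \<le> (\<Sum>A\<in>Cuts. 2 / 4 ^ n)"
      unfolding J_def using feas d n p r
      by (intro sum_mono prob_empty_cut_le) (auto simp: Cuts_def H_def)
    also have "\<dots> = real (card Cuts) * (2 / 4 ^ n)" by simp
    also have "\<dots> \<le> 2 ^ n * (2 / 4 ^ n)"
      using Cuts(2) by (intro mult_right_mono) (auto simp: numeral_power_le_of_nat_cancel_iff)
    also have "(4::real) ^ n = 2 ^ n * 2 ^ n" by (simp flip: power_mult_distrib)
    finally show ?thesis by simp
  qed
  have B2: "measure_pmf.prob J B2 \<le> 1 / r"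
  proof -
    have v: "measure_pmf.prob J {x. v \<in> nonisolated ?V (snd x)} \<le> 1 / r\<^sup>2" if "v \<in> L" for v
    proof -
      have Dv: "real (D v) * p2 \<le> 1 / r\<^sup>2"
      proof -
        have "real (D v) \<le> inverse (r\<^sup>2) * d2" using that by (auto simp: L_def S_def)
        then show ?thesis using d by (simp add: p divide_le_eq field_simps)
      qed
      have "measure_pmf.prob J {(G1, G2). v \<in> nonisolated ?V G2}
        \<le> measure_pmf.prob (random_graph n D) {} + 1 / r\<^sup>2 * (1 - measure_pmf.prob (random_graph n D) {})"
        unfolding J_def
      proof (rule prob_bind_le)
        fix E assume E: "E \<in> set_pmf (random_graph n D)"
        have "measure_pmf.prob (percolation_coupling p1 p2 E) {(G1, G2). v \<in> nonisolated ?V G2}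
          \<le> real (vertex_degree E v) * p2"
          using d graph(2)[OF E] unfolding p by (intro prob_coupling_nonisolated) (auto simp: frac_le)
        also have "vertex_degree E v = D v" using graph(3)[OF E] that sub by auto
        finally show "measure_pmf.prob (percolation_coupling p1 p2 E) {(G1, G2). v \<in> nonisolated ?V G2} \<le> 1 / r\<^sup>2"
          using Dv by linarith
      qed auto
      then show ?thesis by (simp add: case_prod_unfold)
    qed
    have "measure_pmf.prob J B2 \<le> real (card L) * (1 / r\<^sup>2) / (real n / r)"
      unfolding B2_def by (rule prob_card_ge[OF fin(3) v r0])
    also have "\<dots> \<le> real n * (1 / r\<^sup>2) / (real n / r)"
      using card_mono[OF _ sub(3)] r0 by (intro divide_right_mono mult_right_mono) auto
    also have "\<dots> = 1 / r" using n r by (simp add: field_simps power2_eq_square)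
    finally show ?thesis .
  qed
  have good: "x \<in> ?Good" if x: "x \<in> set_pmf J" "x \<notin> B1 \<union> B2" for x
  proof -
    obtain G1 G2 where xG: "x = (G1, G2)" by (metis surj_pair)
    obtain E where E: "E \<in> set_pmf (random_graph n D)" "(G1, G2) \<in> set_pmf (percolation_coupling p1 p2 E)"
      using x(1) by (auto simp: J_def xG)
    have "simple_graph ?V G1"
      using graph(1)[OF E(1)] set_percolation_coupling[OF E(2)] by (auto simp: simple_graph_def)
    moreover have "edge_cut G1 A \<noteq> {}"
      if "A \<subseteq> ?V" "real n / r \<le> real (card (A \<inter> H))" "real n / r \<le> real (card (H - A))" for A
      using x(2) that by (auto simp: B1_def Cuts_def xG)
    ultimately have lower: "real (card H) \<le> real (L1 ?V G1) + 3 * (real n / r)"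
      using sub r0 by (intro L1_ge_of_no_empty_cut) auto
    have "nonisolated ?V G2 \<subseteq> H \<union> M \<union> (L \<inter> nonisolated ?V G2)"
      using sub(4) by (auto simp: nonisolated_def)
    then have "card (nonisolated ?V G2) \<le> card (H \<union> M \<union> (L \<inter> nonisolated ?V G2))"
      using fin by (intro card_mono) auto
    also have "\<dots> \<le> card H + card M + card (L \<inter> nonisolated ?V G2)"
      by (rule order_trans[OF card_Un_le add_right_mono[OF card_Un_le]])
    finally have "L1 ?V G2 \<le> 1 + (card H + card M + card (L \<inter> nonisolated ?V G2))"
      using L1_le_nonisolated[of ?V G2] n by simp
    then have "real (L1 ?V G2) \<le> real (1 + (card H + card M + card (L \<inter> nonisolated ?V G2)))"
      by (rule of_nat_mono)
    moreover have "real (card (L \<inter> nonisolated ?V G2)) < real n / r"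
      using x(2) by (auto simp: B2_def xG)
    ultimately show ?thesis using lower by (simp add: xG)
  qed
  have "1 - measure_pmf.prob J (B1 \<union> B2) = measure_pmf.prob J (- (B1 \<union> B2))"
    using measure_pmf.prob_compl[of "B1 \<union> B2" J] by (simp add: Compl_eq_Diff_UNIV)
  also have "\<dots> = measure_pmf.prob J (- (B1 \<union> B2) \<inter> set_pmf J)"
    by (simp add: measure_Int_set_pmf)
  also have "\<dots> \<le> measure_pmf.prob J ?Good"
    using good by (intro measure_pmf.finite_measure_mono subsetI) auto
  finally have "1 - measure_pmf.prob J (B1 \<union> B2) \<le> measure_pmf.prob J ?Good" .
  moreover have "measure_pmf.prob J (B1 \<union> B2) \<le> measure_pmf.prob J B1 + measure_pmf.prob J B2"
    by (rule measure_Un_le) auto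
  ultimately show ?thesis using B1 B2 by linarith
qed

theorem theorem1p5:
  fixes D :: "nat \<Rightarrow> nat \<Rightarrow> nat"
    and d1 d2 \<omega> p1 p2 :: "nat \<Rightarrow> real"
  assumes D_pos: "\<And>n i. 2 \<le> n \<Longrightarrow> i \<in> {1..n} \<Longrightarrow> 1 \<le> D n i"
    and D_feasible: "\<And>n. 2 \<le> n \<Longrightarrow> feasible n (D n)"
    and d_bounds: "\<And>n. 2 \<le> n \<Longrightarrow> 1 \<le> d2 n \<and> d2 n \<le> d1 n"
    and \<omega>_lim: "filterlim \<omega> at_top sequentially"
    and few_medium:
      "(\<lambda>n. real (card (S n (D n) (inverse (\<omega> n) * d2 n) - S n (D n) (\<omega> n * d1 n))))
         \<in> o(\<lambda>n. real n)"
    and p1_def: "\<And>n. p1 n = 1 / d1 n"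
    and p2_def: "\<And>n. p2 n = 1 / d2 n"
  shows "\<exists>h :: nat \<Rightarrow> real. h \<in> o(\<lambda>n. real n) \<and>
    (\<lambda>n. measure_pmf.prob
            (bind_pmf (random_graph n (D n)) (percolation_coupling (p1 n) (p2 n)))
            {(G1, G2). real (L1 {1..n} G2) - real (L1 {1..n} G1) \<le> h n}) \<longlonglongrightarrow> 1"
proof -
  define M where "M = (\<lambda>n. S n (D n) (inverse (\<omega> n) * d2 n) - S n (D n) (\<omega> n * d1 n))"
  define r where "r = (\<lambda>n. sqrt (\<omega> n))"
  define h where "h = (\<lambda>n. real (card (M n)) + 4 * real n / r n + 1)"
  have r_lim: "filterlim r at_top sequentially"
    unfolding r_def by (rule filterlim_compose[OF sqrt_at_top \<omega>_lim])
  have inv_r: "(\<lambda>n. 1 / r n) \<longlonglongrightarrow> 0"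
    by (rule tendsto_divide_0[OF tendsto_const filterlim_at_top_imp_at_infinity[OF r_lim]])
  have "(\<lambda>n. 4 * real n / r n) \<in> o(\<lambda>n. real n)"
  proof (rule smalloI_tendsto)
    have "(\<lambda>n. 4 * (1 / r n)) \<longlonglongrightarrow> 0" using tendsto_mult_right_zero[OF inv_r] by simp
    moreover have "eventually (\<lambda>n. 4 * (1 / r n) = 4 * real n / r n / real n) sequentially"
      using eventually_gt_at_top[of 0] by eventually_elim simp
    ultimately show "(\<lambda>n. 4 * real n / r n / real n) \<longlonglongrightarrow> 0"
      by (rule Lim_transform_eventually)
    show "eventually (\<lambda>n. real n \<noteq> 0) sequentially"
      using eventually_gt_at_top[of 0] by eventually_elim simp
  qed
  moreover have "(\<lambda>n. 1) \<in> o(\<lambda>n. real n)"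
    by (rule smalloI_tendsto) (use lim_1_over_n eventually_gt_at_top[of "0::nat"] in \<open>auto elim: eventually_mono\<close>)
  ultimately have "h \<in> o(\<lambda>n. real n)"
    unfolding h_def using few_medium by (intro sum_in_smallo) (auto simp: M_def)
  moreover have "(\<lambda>n. measure_pmf.prob
            (bind_pmf (random_graph n (D n)) (percolation_coupling (p1 n) (p2 n)))
            {(G1, G2). real (L1 {1..n} G2) - real (L1 {1..n} G1) \<le> h n}) \<longlonglongrightarrow> 1"
  proof (rule tendsto_sandwich[where h="\<lambda>_. 1" and f="\<lambda>n. 1 - (2 / 2 ^ n + 1 / r n)"])
    have "(\<lambda>n. 2 * (1 / 2) ^ n :: real) \<longlonglongrightarrow> 0"
      by (intro tendsto_mult_right_zero LIMSEQ_realpow_zero) auto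
    then have "(\<lambda>n. 2 / 2 ^ n :: real) \<longlonglongrightarrow> 0"
      by (simp add: power_one_over)
    then have "(\<lambda>n. 1 - (2 / 2 ^ n + 1 / r n)) \<longlonglongrightarrow> 1 - (0 + 0)"
      by (intro tendsto_diff tendsto_add tendsto_const inv_r)
    then show "(\<lambda>n. 1 - (2 / 2 ^ n + 1 / r n)) \<longlonglongrightarrow> 1" by simp
    have "eventually (\<lambda>n. 80 \<le> r n) sequentially"
      using r_lim by (simp add: filterlim_at_top)
    moreover have "eventually (\<lambda>n. 0 \<le> \<omega> n) sequentially"
      using \<omega>_lim by (simp add: filterlim_at_top)
    ultimately show "eventually (\<lambda>n. 1 - (2 / 2 ^ n + 1 / r n) \<le> measure_pmf.prob
            (bind_pmf (random_graph n (D n)) (percolation_coupling (p1 n) (p2 n)))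
            {(G1, G2). real (L1 {1..n} G2) - real (L1 {1..n} G1) \<le> h n}) sequentially"
      using eventually_ge_at_top[of 2]
    proof eventually_elim
      case (elim n)
      have r2: "(r n)\<^sup>2 = \<omega> n" using elim(2) by (simp add: r_def)
      show ?case
        using L1_gap_prob[of n "D n" "d2 n" "d1 n" "p1 n" "p2 n" "r n"] D_feasible[OF elim(3)] d_bounds[OF elim(3)] elim
        by (simp add: r2 p1_def p2_def h_def M_def)
    qed
  qed (auto intro!: always_eventually)
  ultimately show ?thesis by blast
qed

end
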